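(* For every $\tau\in\mathbb{H}^2$, $$\theta'[1,\tfrac23]=\frac13\,\frac{\theta'[1,1]\,\theta^3[1,\frac13]}{\theta^2[1,\frac23]\,\theta[1,0]}.$$
   Context: $\mathbb{H}^2=\{\tau\in\mathbb{C} : \Im\tau>0\}$ is the upper half plane. For $\epsilon,\epsilon'\in\mathbb{R}$, $\zeta\in\mathbb{C}$, $\tau\in\mathbb{H}^2$, the theta function with characteristics is $$\theta[\epsilon,\epsilon'](\zeta,\tau)=\sum_{n\in\mathbb{Z}}\exp\left(2\pi i\left[\tfrac12\left(n+\tfrac{\epsilon}{2}\right)^2\tau+\left(n+\tfrac{\epsilon}{2}\right)\left(\zeta+\tfrac{\epsilon'}{2}\right)\right]\right).$$ Write $\theta[\epsilon,\epsilon']=\theta[\epsilon,\epsilon'](0,\tau)$ and $\theta'[\epsilon,\epsilon']=\frac{\partial}{\partial\zeta}\theta[\epsilon,\epsilon'](\zeta,\tau)\big|_{\zeta=0}$; $\theta^k[\epsilon,\epsilon']$ means the $k$-th power of $\theta[\epsilon,\epsilon']$. *)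

theory Defs
  imports "HOL-Analysis.Analysis"
begin

text \<open>
  For \<open>Im \<tau> > 0\<close> the series converges absolutely, so the unordered sum over the integers is
  the usual two-sided sum. Outside the upper half plane the value is irrelevant.
\<close>

definition theta_char :: "real \<Rightarrow> real \<Rightarrow> complex \<Rightarrow> complex \<Rightarrow> complex" where
  "theta_char \<epsilon> \<epsilon>' \<zeta> \<tau> =
     (\<Sum>\<^sub>\<infinity>n::int. exp (2 * of_real pi * \<i> *
        (1 / 2 * (of_int n + of_real \<epsilon> / 2)\<^sup>2 * \<tau>
          + (of_int n + of_real \<epsilon> / 2) * (\<zeta> + of_real \<epsilon>' / 2))))"

definition theta_const :: "real \<Rightarrow> real \<Rightarrow> complex \<Rightarrow> complex" where
  "theta_const \<epsilon> \<epsilon>' \<tau> = theta_char \<epsilon> \<epsilon>' 0 \<tau>"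

definition theta_deriv_const :: "real \<Rightarrow> real \<Rightarrow> complex \<Rightarrow> complex" where
  "theta_deriv_const \<epsilon> \<epsilon>' \<tau> = deriv (\<lambda>\<zeta>. theta_char \<epsilon> \<epsilon>' \<zeta> \<tau>) 0"

end

theory Submission
  imports Defs "HOL-Complex_Analysis.Complex_Analysis"
begin

text \<open>
  All constants in the identity are values or derivatives of one odd theta function. With
  \<open>S z = theta_char 1 0 (z - 1 / 2) \<tau>\<close>, which satisfies \<open>S (- z) = - S z\<close> and \<open>S (1 - z) = S z\<close>, the claim
  becomes
  \<open>3 * S (1/6) ^ 2 * S (1/2) * S' (1/6) = S' 0 * S (1/3) ^ 3\<close>,
  together with the fact that \<open>S (1/6)\<close> and \<open>S (1/2)\<close> do not vanish.

  The identity is a special case of the addition theorem for the logarithmic derivative of \<open>S\<close>.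
  That theorem comes from linear algebra: \<open>S (x + y) * S (x - y)\<close> is a \<open>2 \<times> 2\<close> determinant
  \<open>A x * B y - B x * A y\<close>, where \<open>A\<close> and \<open>B\<close> are theta functions at \<open>2 * \<tau>\<close> (\<open>theta_odd_product\<close>; the
  double series is regrouped by the parity of the sum of the two indices). Any four vectors in the
  plane satisfy the three-term Pluecker relation between their pairwise determinants, and
  differentiating this relation where two of the vectors merge gives
  \<open>determinant_product_deriv_identity\<close>. At the arguments \<open>1/6\<close>, \<open>0\<close> and \<open>- 1/3\<close>, reflection
  symmetry and \<open>S' (1/2) = 0\<close> leave only the two terms above.

  The determinant also gives the nonvanishing without a product formula or a count of zeros. If
  \<open>S a = 0\<close>, then \<open>A / B\<close> has period \<open>a\<close>. When a multiple of \<open>a\<close> equals \<open>1 / 2\<close> this contradicts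
  \<open>A (x + 1/2) = A x\<close> and \<open>B (x + 1/2) = - B x\<close>, because \<open>A\<close> and \<open>B\<close> are entire and not identically
  zero, the latter by their Fourier coefficients (\<open>theta_odd_nonzero\<close>).
\<close>

section \<open>Convergence and holomorphy of theta series\<close>

text \<open>
  The second characteristic only translates the argument (\<open>theta_char_translate\<close>), so the summand
  is taken with second characteristic \<open>0\<close>.
\<close>
definition theta_term :: "real \<Rightarrow> complex \<Rightarrow> complex \<Rightarrow> int \<Rightarrow> complex" where
  "theta_term \<epsilon> \<zeta> \<tau> n =
     exp (2 * of_real pi * \<i> *
       (1 / 2 * (of_int n + of_real \<epsilon> / 2)\<^sup>2 * \<tau> + (of_int n + of_real \<epsilon> / 2) * \<zeta>))"

lemma theta_char_eq_infsum_term: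
  "theta_char \<epsilon> 0 \<zeta> \<tau> = (\<Sum>\<^sub>\<infinity>n. theta_term \<epsilon> \<zeta> \<tau> n)"
  by (simp add: theta_char_def theta_term_def)

lemma theta_char_translate: "theta_char \<epsilon> \<epsilon>' \<zeta> \<tau> = theta_char \<epsilon> 0 (\<zeta> + of_real \<epsilon>' / 2) \<tau>"
  by (simp add: theta_char_def)

lemma summable_exp_neg_abs_int: "(\<lambda>n::int. exp (- \<bar>real_of_int n\<bar>)) summable_on UNIV"
proof -
  have geo: "(\<lambda>k::nat. exp (- real k)) summable_on UNIV"
  proof (rule norm_summable_imp_summable_on)
    have "summable (\<lambda>k. exp (-1::real) ^ k)"
      by (intro summable_geometric) simp
    then show "summable (\<lambda>k. norm (exp (- real k)))"
      by (simp flip: exp_of_nat_mult)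
  qed
  have pos: "(\<lambda>n::int. exp (- \<bar>real_of_int n\<bar>)) summable_on {0..}"
  proof -
    have "(\<lambda>k::nat. exp (- real k)) summable_on UNIV \<longleftrightarrow>
        (\<lambda>n::int. exp (- \<bar>real_of_int n\<bar>)) summable_on {0..}"
      by (rule summable_on_reindex_bij_witness[of _ nat int]) auto
    with geo show ?thesis by simp
  qed
  have neg: "(\<lambda>n::int. exp (- \<bar>real_of_int n\<bar>)) summable_on {..0}"
  proof -
    have "(\<lambda>n::int. exp (- \<bar>real_of_int n\<bar>)) summable_on {0..} \<longleftrightarrow>
        (\<lambda>n::int. exp (- \<bar>real_of_int n\<bar>)) summable_on {..0}"
      by (rule summable_on_reindex_bij_witness[of _ uminus uminus]) auto
    with pos show ?thesis by simp
  qed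
  have "(\<lambda>n::int. exp (- \<bar>real_of_int n\<bar>)) summable_on ({0..} \<union> ({..0} - {0}))"
    by (intro summable_on_Un_disjoint pos summable_on_subset_banach[OF neg]) auto
  also have "{0..} \<union> ({..0} - {0}) = (UNIV :: int set)" by auto
  finally show ?thesis .
qed

text \<open>
  The Gaussian decay in \<open>n\<close> beats the exponential growth caused by \<open>Im \<zeta>\<close>: with
  \<open>u = n + \<epsilon> / 2\<close>, completing the square in \<open>\<bar>u\<bar>\<close> leaves a spare factor \<open>exp (- \<bar>u\<bar>)\<close>. The majorant
  depends on \<open>\<zeta>\<close> only through \<open>R\<close>, so it gives uniform convergence on horizontal strips.
\<close>
lemma norm_theta_term_le:
  assumes "Im \<tau> > 0" and "\<bar>Im \<zeta>\<bar> \<le> R"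
  shows "norm (theta_term \<epsilon> \<zeta> \<tau> n) \<le>
    exp ((2 * pi * R + 1)\<^sup>2 / (4 * pi * Im \<tau>) + \<bar>\<epsilon>\<bar> / 2) * exp (- \<bar>real_of_int n\<bar>)"
proof -
  define u where "u = real_of_int n + \<epsilon> / 2"
  define a where "a = pi * Im \<tau>"
  define b where "b = 2 * pi * R"
  have a: "a > 0" using assms by (simp add: a_def)
  have u: "of_int n + of_real \<epsilon> / 2 = (of_real u :: complex)" by (simp add: u_def)
  have "norm (theta_term \<epsilon> \<zeta> \<tau> n) = exp (- a * u\<^sup>2 - 2 * pi * (u * Im \<zeta>))"
    unfolding theta_term_def u a_def by (simp add: norm_exp_eq_Re algebra_simps flip: of_real_power)
  also have "- a * u\<^sup>2 - 2 * pi * (u * Im \<zeta>) \<le> - a * u\<^sup>2 + b * \<bar>u\<bar>"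
  proof -
    have "- (u * Im \<zeta>) \<le> \<bar>u\<bar> * R"
      using mult_left_mono[OF assms(2) abs_ge_zero[of u]] abs_ge_minus_self[of "u * Im \<zeta>"]
      by (simp add: abs_mult)
    then have "2 * pi * (- (u * Im \<zeta>)) \<le> 2 * pi * (\<bar>u\<bar> * R)"
      by (intro mult_left_mono) auto
    then show ?thesis by (simp add: b_def algebra_simps)
  qed
  also have "- a * u\<^sup>2 + b * \<bar>u\<bar> = (b + 1)\<^sup>2 / (4 * a) - \<bar>u\<bar> - a * (\<bar>u\<bar> - (b + 1) / (2 * a))\<^sup>2"
  proof -
    have "- a * w\<^sup>2 + b * w = (b + 1)\<^sup>2 / (4 * a) - w - a * (w - (b + 1) / (2 * a))\<^sup>2" for w
      using a by (simp add: field_simps power2_eq_square)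
    from this[of "\<bar>u\<bar>"] show ?thesis by simp
  qed
  also have "\<dots> \<le> (b + 1)\<^sup>2 / (4 * a) - \<bar>u\<bar>" using a by simp
  also have "\<dots> \<le> (b + 1)\<^sup>2 / (4 * a) + \<bar>\<epsilon>\<bar> / 2 - \<bar>real_of_int n\<bar>"
    unfolding u_def by linarith
  finally show ?thesis by (simp add: a_def b_def mult.assoc flip: exp_add)
qed

lemma theta_term_abs_summable:
  assumes "Im \<tau> > 0"
  shows "(\<lambda>n. norm (theta_term \<epsilon> \<zeta> \<tau> n)) summable_on UNIV"
  by (rule Infinite_Sum.abs_summable_on_comparison_test'[OF summable_on_cmult_right[OF summable_exp_neg_abs_int]
        norm_theta_term_le[OF assms order_refl]])

lemma theta_term_has_sum:
  assumes "Im \<tau> > 0"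
  shows "(theta_term \<epsilon> \<zeta> \<tau> has_sum theta_char \<epsilon> 0 \<zeta> \<tau>) UNIV"
  unfolding theta_char_eq_infsum_term
  by (rule has_sum_infsum[OF abs_summable_summable[OF theta_term_abs_summable[OF assms]]])

lemma theta_char_uniform_limit:
  assumes "Im \<tau> > 0" and "\<And>\<zeta>. \<zeta> \<in> Y \<Longrightarrow> \<bar>Im \<zeta>\<bar> \<le> R"
  shows "uniform_limit Y (\<lambda>X \<zeta>. \<Sum>n\<in>X. theta_term \<epsilon> \<zeta> \<tau> n) (\<lambda>\<zeta>. theta_char \<epsilon> 0 \<zeta> \<tau>)
           (finite_subsets_at_top UNIV)"
  unfolding theta_char_eq_infsum_term
  by (rule Weierstrass_m_test_general[OF norm_theta_term_le[OF assms(1) assms(2)]])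
     (auto intro: summable_on_cmult_right summable_exp_neg_abs_int)

lemma theta_char_holomorphic:
  assumes "Im \<tau> > 0"
  shows "(\<lambda>\<zeta>. theta_char \<epsilon> 0 \<zeta> \<tau>) holomorphic_on UNIV"
proof -
  have "(\<lambda>\<zeta>. theta_char \<epsilon> 0 \<zeta> \<tau>) holomorphic_on ball z 1" for z
  proof (rule holomorphic_uniform_limit)
    show "uniform_limit (cball z 1) (\<lambda>X \<zeta>. \<Sum>n\<in>X. theta_term \<epsilon> \<zeta> \<tau> n)
            (\<lambda>\<zeta>. theta_char \<epsilon> 0 \<zeta> \<tau>) (finite_subsets_at_top UNIV)"
    proof (rule theta_char_uniform_limit[OF assms])
      fix \<zeta> assume "\<zeta> \<in> cball z 1"
      then have "\<bar>Im (\<zeta> - z)\<bar> \<le> 1"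
        by (metis abs_Im_le_cmod dist_complex_def dist_commute mem_cball order_trans)
      then show "\<bar>Im \<zeta>\<bar> \<le> \<bar>Im z\<bar> + 1" by simp
    qed
  qed (auto simp: theta_term_def intro!: always_eventually continuous_intros holomorphic_intros)
  then have "(\<lambda>\<zeta>. theta_char \<epsilon> 0 \<zeta> \<tau>) field_differentiable at z" for z
    by (metis holomorphic_on_imp_differentiable_at open_ball centre_in_ball zero_less_one)
  then show ?thesis by (simp add: holomorphic_on_def field_differentiable_at_within)
qed

section \<open>Parity, translation and the product of two theta series\<close>

lemma theta_char_1_even: "theta_char 1 0 (- \<zeta>) \<tau> = theta_char 1 0 \<zeta> \<tau>"
proof -
  have reflect: "theta_term 1 z \<tau> (- n - 1) = theta_term 1 (- z) \<tau> n" for z n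
    unfolding theta_term_def by (rule arg_cong[of _ _ exp]) (simp add: field_simps power2_eq_square)
  show ?thesis
    unfolding theta_char_eq_infsum_term
    by (rule infsum_reindex_bij_witness[of UNIV "\<lambda>n. - n - 1" "\<lambda>n. - n - 1"]) (simp_all add: reflect)
qed

lemma theta_term_plus_1:
  "theta_term \<epsilon> (\<zeta> + 1) \<tau> n = exp (of_real pi * \<i> * of_real \<epsilon>) * theta_term \<epsilon> \<zeta> \<tau> n"
proof -
  have "theta_term \<epsilon> (\<zeta> + 1) \<tau> n =
    exp (2 * of_int n * of_real pi * \<i>) * (exp (of_real pi * \<i> * of_real \<epsilon>) * theta_term \<epsilon> \<zeta> \<tau> n)"
    unfolding theta_term_def exp_add[symmetric] by (rule arg_cong[of _ _ exp]) (simp add: algebra_simps)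
  also have "exp (2 * of_int n * of_real pi * \<i>) = 1"
    using exp_integer_2pi[of "of_int n"] by (simp add: mult_ac)
  finally show ?thesis by simp
qed

lemma theta_char_plus_1:
  "theta_char \<epsilon> 0 (\<zeta> + 1) \<tau> = exp (of_real pi * \<i> * of_real \<epsilon>) * theta_char \<epsilon> 0 \<zeta> \<tau>"
  unfolding theta_char_eq_infsum_term theta_term_plus_1 by (rule infsum_cmult_right')

lemma has_sum_product:
  fixes f :: "'a \<Rightarrow> complex" and g :: "'b \<Rightarrow> complex"
  assumes "(f has_sum a) A" "(g has_sum b) B"
    and "(\<lambda>x. norm (f x)) summable_on A" "(\<lambda>y. norm (g y)) summable_on B"
  shows "((\<lambda>(x, y). f x * g y) has_sum a * b) (A \<times> B)"
proof (rule has_sum_SigmaI)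
  show "((\<lambda>y. case (x, y) of (x, y) \<Rightarrow> f x * g y) has_sum f x * b) B" for x
    using has_sum_cmult_right[OF assms(2)] by simp
  show "((\<lambda>x. f x * b) has_sum a * b) A"
    by (rule has_sum_cmult_left[OF assms(1)])
  have "(\<lambda>p. norm (case p of (x, y) \<Rightarrow> f x * g y)) summable_on A \<times> B"
    unfolding Infinite_Sum.abs_summable_on_Sigma_iff using assms(3,4)
    by (auto simp: norm_mult infsum_cmult_right' infsum_nonneg
             intro!: summable_on_cmult_left summable_on_cmult_right)
  then show "(\<lambda>(x, y). f x * g y) summable_on A \<times> B"
    by (rule abs_summable_summable)
qed

text \<open>
  In the double series over half-integers \<open>m + 1/2\<close> and \<open>n + 1/2\<close>, pass to half the sum \<open>p\<close> and half
  the difference \<open>r\<close>. The squares add up to \<open>2 * (p\<^sup>2 + r\<^sup>2)\<close>, which doubles \<open>\<tau>\<close>, and the exponent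
  \<open>(m + 1/2) * (x + y) + (n + 1/2) * (x - y)\<close> becomes \<open>2 * p * x + 2 * r * y\<close>, which separates the variables.
  For odd \<open>m + n\<close>, \<open>p\<close> is an integer and \<open>r\<close> is half of an odd number; for even \<open>m + n\<close> it is the
  other way round. The two cases give the two products on the right.
\<close>
lemma theta_addition:
  assumes "Im \<tau> > 0"
  shows "theta_char 1 0 (x + y) \<tau> * theta_char 1 0 (x - y) \<tau> =
    theta_char 0 0 (2 * x) (2 * \<tau>) * theta_char 1 0 (2 * y) (2 * \<tau>) +
    theta_char 1 0 (2 * x) (2 * \<tau>) * theta_char 0 0 (2 * y) (2 * \<tau>)"
proof -
  have \<tau>2: "Im (2 * \<tau>) > 0" using assms by simp
  let ?F = "\<lambda>(m, n). theta_term 1 (x + y) \<tau> m * theta_term 1 (x - y) \<tau> n"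
  let ?odd = "{p::int \<times> int. odd (fst p + snd p)}" and ?even = "{p::int \<times> int. even (fst p + snd p)}"
  have prod: "((\<lambda>(k, l). theta_term \<epsilon> (2 * x) (2 * \<tau>) k * theta_term \<epsilon>' (2 * y) (2 * \<tau>) l) has_sum
     theta_char \<epsilon> 0 (2 * x) (2 * \<tau>) * theta_char \<epsilon>' 0 (2 * y) (2 * \<tau>)) (UNIV \<times> UNIV)" for \<epsilon> \<epsilon>'
    by (intro has_sum_product theta_term_has_sum theta_term_abs_summable \<tau>2)
  have term_odd: "theta_term 1 (x + y) \<tau> (k + l) * theta_term 1 (x - y) \<tau> (k - l - 1) =
      theta_term 0 (2 * x) (2 * \<tau>) k * theta_term 1 (2 * y) (2 * \<tau>) l" for k l
    unfolding theta_term_def exp_add[symmetric]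
    by (rule arg_cong[of _ _ exp]) (simp add: field_simps power2_eq_square)
  have term_even: "theta_term 1 (x + y) \<tau> (k + l) * theta_term 1 (x - y) \<tau> (k - l) =
      theta_term 1 (2 * x) (2 * \<tau>) k * theta_term 0 (2 * y) (2 * \<tau>) l" for k l
    unfolding theta_term_def exp_add[symmetric]
    by (rule arg_cong[of _ _ exp]) (simp add: field_simps power2_eq_square)
  have bij_odd: "bij_betw (\<lambda>(k, l). (k + l, k - l - 1)) (UNIV \<times> UNIV) ?odd"
  proof (rule bij_betw_byWitness[where f' = "\<lambda>(m, n). ((m + n + 1) div 2, (m - n - 1) div 2)"])
    show "\<forall>p\<in>?odd. (\<lambda>(k, l). (k + l, k - l - 1)) ((\<lambda>(m, n). ((m + n + 1) div 2, (m - n - 1) div 2)) p) = p"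
      by (clarsimp, presburger)
  qed auto
  have bij_even: "bij_betw (\<lambda>(k, l). (k + l, k - l)) (UNIV \<times> UNIV) ?even"
  proof (rule bij_betw_byWitness[where f' = "\<lambda>(m, n). ((m + n) div 2, (m - n) div 2)"])
    show "\<forall>p\<in>?even. (\<lambda>(k, l). (k + l, k - l)) ((\<lambda>(m, n). ((m + n) div 2, (m - n) div 2)) p) = p"
      by (clarsimp, presburger)
  qed auto
  have "(?F has_sum theta_char 0 0 (2 * x) (2 * \<tau>) * theta_char 1 0 (2 * y) (2 * \<tau>)) ?odd"
    unfolding has_sum_reindex_bij_betw[OF bij_odd, symmetric]
    using prod[of 0 1] by (simp add: term_odd case_prod_unfold)
  moreover have "(?F has_sum theta_char 1 0 (2 * x) (2 * \<tau>) * theta_char 0 0 (2 * y) (2 * \<tau>)) ?even"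
    unfolding has_sum_reindex_bij_betw[OF bij_even, symmetric]
    using prod[of 1 0] by (simp add: term_even case_prod_unfold)
  ultimately have split: "(?F has_sum
      theta_char 0 0 (2 * x) (2 * \<tau>) * theta_char 1 0 (2 * y) (2 * \<tau>) +
      theta_char 1 0 (2 * x) (2 * \<tau>) * theta_char 0 0 (2 * y) (2 * \<tau>)) (?odd \<union> ?even)"
    by (rule has_sum_Un_disjoint) auto
  have cover: "?odd \<union> ?even = UNIV \<times> UNIV" by auto
  have "(?F has_sum theta_char 1 0 (x + y) \<tau> * theta_char 1 0 (x - y) \<tau>) (UNIV \<times> UNIV)"
    by (intro has_sum_product theta_term_has_sum theta_term_abs_summable assms)
  from has_sum_unique[OF this split[unfolded cover]] show ?thesis .
qed

section \<open>Theta series do not vanish identically\<close>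

lemma integral_exp_2pi_int:
  "((\<lambda>x. exp (2 * of_real pi * \<i> * of_int n * of_real x)) has_integral (if n = 0 then 1 else 0)) {0..1::real}"
proof (cases "n = 0")
  case True
  then show ?thesis using has_integral_const_real[of "1::complex" 0 1] by simp
next
  case False
  define c where "c = 2 * of_real pi * \<i> * of_int n"
  have c: "c \<noteq> 0" using False by (simp add: c_def)
  have "((\<lambda>x. exp (c * of_real x)) has_integral exp (c * of_real 1) / c - exp (c * of_real 0) / c) {0..1}"
  proof (rule fundamental_theorem_of_calculus)
    fix x :: real
    have "((\<lambda>z. exp (c * z) / c) has_field_derivative exp (c * of_real x)) (at (of_real x))"
      using c by (auto intro!: derivative_eq_intros)
    then show "((\<lambda>x. exp (c * of_real x) / c) has_vector_derivative exp (c * of_real x)) (at x within {0..1})"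
      by (rule has_vector_derivative_real_field)
  qed simp
  moreover have "exp c = 1"
    using exp_integer_2pi[of "of_int n"] by (simp add: c_def mult_ac)
  ultimately show ?thesis using False by (simp add: c_def)
qed

text \<open>
  On the real axis the series is, up to the factor \<open>exp (\<pi> * \<i> * \<epsilon> * x)\<close>, a uniformly convergent
  Fourier series whose coefficients are exponentials. If the sum were \<open>0\<close>, integrating it over a
  period would force its constant coefficient to be \<open>0\<close>.
\<close>
lemma theta_char_not_identically_zero:
  assumes "Im \<tau> > 0"
  shows "\<exists>\<zeta>. theta_char \<epsilon> 0 \<zeta> \<tau> \<noteq> 0"
proof (rule ccontr)
  assume "\<not> ?thesis"
  then have zero: "theta_char \<epsilon> 0 \<zeta> \<tau> = 0" for \<zeta> by blast
  define c where "c n = exp (of_real pi * \<i> * (of_int n + of_real \<epsilon> / 2)\<^sup>2 * \<tau>)" for n :: int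
  define e where "e x = exp (- (of_real pi * \<i> * of_real \<epsilon> * of_real x))" for x :: real
  let ?F = "\<lambda>X x. \<Sum>n\<in>X. theta_term \<epsilon> (of_real x) \<tau> n * e x"
  have term_eq: "theta_term \<epsilon> (of_real x) \<tau> n * e x = c n * exp (2 * of_real pi * \<i> * of_int n * of_real x)"
    for n and x :: real
    unfolding theta_term_def c_def e_def exp_add[symmetric]
    by (rule arg_cong[of _ _ exp]) (simp add: algebra_simps)
  have int: "(?F X has_integral (if 0 \<in> X then c 0 else 0)) {0..1}" if "finite X" for X
  proof -
    have "(?F X has_integral (\<Sum>n\<in>X. c n * (if n = 0 then 1 else 0))) {0..1}"
      unfolding term_eq by (intro has_integral_sum that has_integral_mult_right integral_exp_2pi_int)
    then show ?thesis using that by (simp add: if_distrib sum.delta cong: if_cong)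
  qed
  have "uniform_limit {0..1} (\<lambda>X x. \<Sum>n\<in>X. theta_term \<epsilon> (of_real x) \<tau> n * e x)
      (\<lambda>x. \<Sum>\<^sub>\<infinity>n. theta_term \<epsilon> (of_real x) \<tau> n * e x) (finite_subsets_at_top UNIV)"
  proof (rule Weierstrass_m_test_general)
    fix n and x :: real
    have "norm (e x) = 1" by (simp add: e_def norm_exp_eq_Re)
    then show "norm (theta_term \<epsilon> (of_real x) \<tau> n * e x) \<le>
       exp ((2 * pi * 0 + 1)\<^sup>2 / (4 * pi * Im \<tau>) + \<bar>\<epsilon>\<bar> / 2) * exp (- \<bar>real_of_int n\<bar>)"
      unfolding norm_mult using norm_theta_term_le[OF assms, of "of_real x" 0 \<epsilon> n] by simp
  qed (intro summable_on_cmult_right summable_exp_neg_abs_int)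
  also have "(\<lambda>x. \<Sum>\<^sub>\<infinity>n. theta_term \<epsilon> (of_real x) \<tau> n * e x) = (\<lambda>x. 0)"
    by (simp add: infsum_cmult_left' zero flip: theta_char_eq_infsum_term)
  finally obtain I J where IJ: "\<And>X. (?F X has_integral I X) {0..1}"
      "((\<lambda>x. 0) has_integral J) {0..1::real}" "(I \<longlongrightarrow> J) (finite_subsets_at_top UNIV)"
    by (rule uniform_limit_integral) (auto simp: theta_term_def e_def intro!: continuous_intros)
  have "J = 0" using IJ(2) by (simp add: has_integral_0_eq)
  moreover have "\<forall>\<^sub>F X in finite_subsets_at_top UNIV. I X = c 0"
  proof (rule eventually_finite_subsets_at_top[THEN iffD2], intro exI conjI allI impI)
    fix X :: "int set" assume "finite X \<and> {0} \<subseteq> X \<and> X \<subseteq> UNIV"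
    then show "I X = c 0" using int[of X] IJ(1)[of X] by (auto dest: has_integral_unique)
  qed auto
  ultimately have "c 0 = 0"
    using IJ(3) by (metis tendsto_eventually tendsto_unique finite_subsets_at_top_neq_bot)
  then show False by (simp add: c_def)
qed


section \<open>The odd theta function and its addition theorem\<close>

text \<open>
  Up to sign this is Jacobi's first theta function. The shift by \<open>1 / 2\<close> fixes one of the two theta
  functions at \<open>2 * \<tau>\<close> and negates the other, which turns the sum in \<open>theta_addition\<close> into a
  determinant.
\<close>
definition theta_odd :: "complex \<Rightarrow> complex \<Rightarrow> complex" where
  "theta_odd \<tau> z = theta_char 1 0 (z - 1 / 2) \<tau>"

lemma theta_odd_product:
  assumes "Im \<tau> > 0"
  shows "theta_odd \<tau> (x + y) * theta_odd \<tau> (x - y) =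
    theta_char 0 0 (2 * x) (2 * \<tau>) * theta_char 1 0 (2 * y) (2 * \<tau>) -
    theta_char 1 0 (2 * x) (2 * \<tau>) * theta_char 0 0 (2 * y) (2 * \<tau>)"
proof -
  have args: "x + y - 1 / 2 = x - 1 / 2 + y" "x - y - 1 / 2 = x - 1 / 2 - y" "2 * (x - 1 / 2) = 2 * x - 1"
    by (simp_all add: algebra_simps)
  have shift: "theta_char 0 0 (2 * x) (2 * \<tau>) = theta_char 0 0 (2 * x - 1) (2 * \<tau>)"
    "theta_char 1 0 (2 * x) (2 * \<tau>) = - theta_char 1 0 (2 * x - 1) (2 * \<tau>)"
    using theta_char_plus_1[of 0 "2 * x - 1" "2 * \<tau>"] theta_char_plus_1[of 1 "2 * x - 1" "2 * \<tau>"]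
    by simp_all
  show ?thesis
    unfolding theta_odd_def args theta_addition[OF assms] shift by simp
qed

lemma theta_odd_reflect: "theta_odd \<tau> (1 - z) = theta_odd \<tau> z"
proof -
  have "1 - z - 1 / 2 = - (z - 1 / 2)" by simp
  then show ?thesis unfolding theta_odd_def by (simp only: theta_char_1_even)
qed

lemma theta_odd_minus: "theta_odd \<tau> (- z) = - theta_odd \<tau> z"
proof -
  have "theta_odd \<tau> (- z) = theta_char 1 0 (- (z - 1 / 2 + 1)) \<tau>"
    unfolding theta_odd_def by (rule arg_cong[of _ _ "\<lambda>w. theta_char 1 0 w \<tau>"]) (simp add: algebra_simps)
  also have "\<dots> = - theta_odd \<tau> z"
    unfolding theta_char_1_even theta_char_plus_1 by (simp add: theta_odd_def)
  finally show ?thesis .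
qed

lemma theta_odd_has_deriv:
  assumes "Im \<tau> > 0"
  shows "(theta_odd \<tau> has_field_derivative deriv (theta_odd \<tau>) z) (at z)"
proof -
  have "(\<lambda>z. z - 1 / 2) holomorphic_on UNIV" by (intro holomorphic_intros)
  from holomorphic_on_compose_gen[OF this theta_char_holomorphic[OF assms]]
  have "theta_odd \<tau> holomorphic_on UNIV" by (simp add: theta_odd_def[abs_def] o_def)
  then show ?thesis by (rule holomorphic_derivI) auto
qed

lemma deriv_theta_odd_minus:
  assumes "Im \<tau> > 0"
  shows "deriv (theta_odd \<tau>) (- z) = deriv (theta_odd \<tau>) z"
proof -
  have "((\<lambda>w. - theta_odd \<tau> (- w)) has_field_derivative deriv (theta_odd \<tau>) (- z)) (at z)"
    by (auto intro!: derivative_eq_intros DERIV_chain2[OF theta_odd_has_deriv[OF assms]])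
  then show ?thesis
    using theta_odd_has_deriv[OF assms, of z] by (simp add: theta_odd_minus DERIV_unique)
qed

lemma deriv_theta_odd_reflect:
  assumes "Im \<tau> > 0"
  shows "deriv (theta_odd \<tau>) (1 - z) = - deriv (theta_odd \<tau>) z"
proof -
  have "((\<lambda>w. 1 - w) has_field_derivative - 1) (at z)"
    by (auto intro!: derivative_eq_intros)
  from DERIV_chain2[OF theta_odd_has_deriv[OF assms] this] have "- deriv (theta_odd \<tau>) (1 - z) = deriv (theta_odd \<tau>) z"
    using theta_odd_has_deriv[OF assms, of z] by (simp add: theta_odd_reflect DERIV_unique)
  then show ?thesis by (metis minus_minus)
qed

text \<open>
  The Pluecker relation for the vectors \<open>(A, B)\<close> at \<open>x, y, u, v\<close>, differentiated in \<open>y\<close> at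
  \<open>y = x\<close>. Since \<open>S 0 = 0\<close>, the product \<open>S (x + y) * S (x - y)\<close> contributes only \<open>- S (2 * x) * S' 0\<close>.
  Divided by the four values \<open>S (x \<plusminus> u)\<close>, \<open>S (x \<plusminus> v)\<close>, this expresses
  \<open>Z (x + u) + Z (x - u) - Z (x + v) - Z (x - v)\<close> for the logarithmic derivative \<open>Z = S' / S\<close>.
\<close>
lemma determinant_product_deriv_identity:
  fixes S S' A B :: "complex \<Rightarrow> complex"
  assumes product: "\<And>x y. S (x + y) * S (x - y) = A x * B y - B x * A y"
    and deriv: "\<And>z. (S has_field_derivative S' z) (at z)"
  shows "S' 0 * S (2 * x) * (S (u + v) * S (u - v)) =
    S (x + v) * S (x - v) * (S' (x + u) * S (x - u) + S (x + u) * S' (x - u)) -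
    S (x + u) * S (x - u) * (S' (x + v) * S (x - v) + S (x + v) * S' (x - v))"
proof -
  have S0: "S 0 = 0" using product[of 0 0] by simp
  have shift: "((\<lambda>y. S (c + y)) has_field_derivative S' (c + z)) (at z)"
    "((\<lambda>y. S (y + c)) has_field_derivative S' (z + c)) (at z)"
    "((\<lambda>y. S (y - c)) has_field_derivative S' (z - c)) (at z)" for c z
    using deriv[of "z + c"] deriv[of "z - c"] DERIV_shift[of S _ z c] DERIV_shift[of S _ z "- c"]
    by (simp_all add: add.commute)
  have reflect: "((\<lambda>y. S (c - y)) has_field_derivative - S' (c - z)) (at z)" for c z
  proof -
    have "((\<lambda>y. c - y) has_field_derivative - 1) (at z)"
      by (auto intro!: derivative_eq_intros)
    from DERIV_chain2[OF deriv this] show ?thesis by simp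
  qed
  have sym: "((\<lambda>y. S (y + c) * S (y - c)) has_field_derivative
      S' (z + c) * S (z - c) + S (z + c) * S' (z - c)) (at z)" for c z
    by (rule DERIV_cong[OF DERIV_mult[OF shift(2) shift(3)]]) simp
  have diag: "((\<lambda>y. S (x + y) * S (x - y)) has_field_derivative - (S (2 * x) * S' 0)) (at x)"
    by (rule DERIV_cong[OF DERIV_mult[OF shift(1) reflect]]) (simp add: S0 flip: mult_2)
  define G where "G y = S (x + y) * S (x - y) * (S (u + v) * S (u - v))
      - S (x + u) * S (x - u) * (S (y + v) * S (y - v))
      + S (x + v) * S (x - v) * (S (y + u) * S (y - u))" for y
  define D where "D = - (S (2 * x) * S' 0) * (S (u + v) * S (u - v))
      - S (x + u) * S (x - u) * (S' (x + v) * S (x - v) + S (x + v) * S' (x - v))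
      + S (x + v) * S (x - v) * (S' (x + u) * S (x - u) + S (x + u) * S' (x - u))"
  have "G y = 0" for y
    unfolding G_def product by algebra
  then have "G = (\<lambda>y. 0)" by blast
  moreover have "(G has_field_derivative D) (at x)"
    unfolding G_def D_def
    by (rule DERIV_add[OF DERIV_diff[OF DERIV_cmult_right[OF diag] DERIV_cmult[OF sym]] DERIV_cmult[OF sym]])
  ultimately have "D = 0"
    using DERIV_unique[OF _ DERIV_const] by blast
  then show ?thesis by (simp add: D_def algebra_simps)
qed

section \<open>Nonvanishing at fractions of the half-period\<close>

text \<open>
  Phrased with a filter so that finitely many such translates can be combined: all of them are
  nonzero at a common point near \<open>0\<close>.
\<close>
lemma theta_char_eventually_nonzero:
  assumes "Im \<tau> > 0"
  shows "\<forall>\<^sub>F x in at 0. theta_char \<epsilon> 0 (2 * (x + d)) (2 * \<tau>) \<noteq> 0"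
proof -
  have \<tau>2: "Im (2 * \<tau>) > 0" using assms by simp
  obtain \<zeta> where \<zeta>: "theta_char \<epsilon> 0 \<zeta> (2 * \<tau>) \<noteq> 0"
    using theta_char_not_identically_zero[OF \<tau>2] by blast
  have "(\<lambda>x. 2 * (x + d)) holomorphic_on UNIV" by (intro holomorphic_intros)
  from holomorphic_on_compose_gen[OF this theta_char_holomorphic[OF \<tau>2]]
  have "(\<lambda>x. theta_char \<epsilon> 0 (2 * (x + d)) (2 * \<tau>)) holomorphic_on UNIV" by (simp add: o_def)
  then have "\<forall>\<^sub>F x in at 0. theta_char \<epsilon> 0 (2 * (x + d)) (2 * \<tau>) \<noteq> 0 \<and> x \<in> UNIV"
    by (rule non_zero_neighbour_alt[where \<beta> = "\<zeta> / 2 - d"]) (use \<zeta> in \<open>auto simp: algebra_simps\<close>)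
  then show ?thesis by simp
qed

text \<open>
  A zero \<open>a\<close> of the odd theta function makes the determinant at \<open>y + a\<close> and \<open>y\<close> vanish for every \<open>y\<close>,
  so \<open>A / B\<close> takes the same value at \<open>x, x + a, \<dots>, x + N * a = x + 1/2\<close>. But translation by
  \<open>1/2\<close> changes the sign of \<open>B\<close> and fixes \<open>A\<close>.
\<close>
lemma theta_odd_nonzero:
  assumes "Im \<tau> > 0" and N: "of_nat N * a = 1 / 2"
  shows "theta_odd \<tau> a \<noteq> 0"
proof
  assume zero: "theta_odd \<tau> a = 0"
  define A where "A x = theta_char 0 0 (2 * x) (2 * \<tau>)" for x
  define B where "B x = theta_char 1 0 (2 * x) (2 * \<tau>)" for x
  have "\<forall>\<^sub>F x in at 0. \<forall>k\<in>{..N}. A (x + of_nat k * a) \<noteq> 0 \<and> B (x + of_nat k * a) \<noteq> 0"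
    unfolding A_def B_def
    by (intro eventually_ball_finite ballI eventually_conj theta_char_eventually_nonzero assms) simp
  from eventually_happens'[OF _ this]
  obtain x where "\<forall>k\<in>{..N}. A (x + of_nat k * a) \<noteq> 0 \<and> B (x + of_nat k * a) \<noteq> 0"
    by auto
  then have x: "A (x + of_nat k * a) \<noteq> 0 \<and> B (x + of_nat k * a) \<noteq> 0" if "k \<le> N" for k
    using that by simp
  have ratio: "A (x + of_nat k * a) / B (x + of_nat k * a) = A x / B x" if "k \<le> N" for k
    using that
  proof (induction k)
    case (Suc k)
    let ?y = "x + of_nat k * a" and ?z = "x + of_nat (Suc k) * a"
    have "?z - ?y = a" by (simp add: algebra_simps)
    then have "A ?z * B ?y - B ?z * A ?y = 0"
      using theta_odd_product[OF assms(1), of ?z ?y] zero unfolding A_def B_def by simp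
    then have "A ?z / B ?z = A ?y / B ?y"
      using x[of k] x[of "Suc k"] Suc.prems by (simp add: frac_eq_eq mult.commute)
    with Suc show ?case by simp
  qed simp
  have "A (x + 1 / 2) = A x" "B (x + 1 / 2) = - B x"
    using theta_char_plus_1[of 0 "2 * x" "2 * \<tau>"] theta_char_plus_1[of 1 "2 * x" "2 * \<tau>"]
    by (simp_all add: A_def B_def algebra_simps)
  with ratio[of N] N x[of 0] show False by simp
qed

section \<open>The identity for theta constants\<close>

lemma theta_const_eq_theta_odd: "theta_const 1 \<epsilon>' \<tau> = theta_odd \<tau> (of_real ((1 + \<epsilon>') / 2))"
  unfolding theta_const_def theta_char_translate[of _ \<epsilon>'] theta_odd_def
  by (rule arg_cong[of _ _ "\<lambda>z. theta_char 1 0 z \<tau>"]) (simp add: field_simps)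

lemma theta_deriv_const_eq_deriv_theta_odd:
  assumes "Im \<tau> > 0"
  shows "theta_deriv_const 1 \<epsilon>' \<tau> = deriv (theta_odd \<tau>) (of_real ((1 + \<epsilon>') / 2))"
proof -
  have "(\<lambda>\<zeta>. theta_char 1 \<epsilon>' \<zeta> \<tau>) = (\<lambda>\<zeta>. theta_odd \<tau> (\<zeta> + of_real ((1 + \<epsilon>') / 2)))"
    unfolding theta_char_translate[of _ \<epsilon>'] theta_odd_def
    by (intro ext arg_cong[of _ _ "\<lambda>z. theta_char 1 0 z \<tau>"]) (simp add: field_simps)
  moreover have "((\<lambda>\<zeta>. theta_odd \<tau> (\<zeta> + of_real ((1 + \<epsilon>') / 2))) has_field_derivative
      deriv (theta_odd \<tau>) (of_real ((1 + \<epsilon>') / 2))) (at 0)"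
    using theta_odd_has_deriv[OF assms, of "0 + of_real ((1 + \<epsilon>') / 2)"]
    by (subst (asm) DERIV_shift) simp
  ultimately show ?thesis unfolding theta_deriv_const_def by (simp add: DERIV_imp_deriv)
qed

theorem theorem5p10:
  fixes \<tau> :: complex
  assumes "Im \<tau> > 0"
  shows "theta_deriv_const 1 (2 / 3) \<tau> =
    1 / 3 * (theta_deriv_const 1 1 \<tau> * theta_const 1 (1 / 3) \<tau> ^ 3
              / (theta_const 1 (2 / 3) \<tau> ^ 2 * theta_const 1 0 \<tau>))"
proof -
  let ?S = "theta_odd \<tau>" and ?S' = "deriv (theta_odd \<tau>)"
  have "?S' (1 / 2) = 0"
    using deriv_theta_odd_reflect[OF assms, of "1 / 2"] by simp
  \<comment> \<open>The addition theorem with \<open>x + u = x - u = 1/6\<close>, \<open>x + v = - 1/6\<close> and \<open>x - v = 1/2\<close>: three of the four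
    logarithmic derivatives agree up to sign, and the fourth vanishes.\<close>
  moreover have "?S' 0 * ?S (2 * (1 / 6)) * (?S (0 + - (1 / 3)) * ?S (0 - - (1 / 3))) =
    ?S (1 / 6 + - (1 / 3)) * ?S (1 / 6 - - (1 / 3)) *
      (?S' (1 / 6 + 0) * ?S (1 / 6 - 0) + ?S (1 / 6 + 0) * ?S' (1 / 6 - 0)) -
    ?S (1 / 6 + 0) * ?S (1 / 6 - 0) *
      (?S' (1 / 6 + - (1 / 3)) * ?S (1 / 6 - - (1 / 3)) + ?S (1 / 6 + - (1 / 3)) * ?S' (1 / 6 - - (1 / 3)))"
    by (rule determinant_product_deriv_identity[where A = "\<lambda>x. theta_char 0 0 (2 * x) (2 * \<tau>)"
          and B = "\<lambda>x. theta_char 1 0 (2 * x) (2 * \<tau>)"])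
       (rule theta_odd_product[OF assms] theta_odd_has_deriv[OF assms])+
  ultimately have key: "?S' 0 * ?S (1 / 3) ^ 3 = 3 * (?S (1 / 6) ^ 2 * ?S (1 / 2)) * ?S' (1 / 6)"
    using theta_odd_minus[of \<tau> "1 / 3"] theta_odd_minus[of \<tau> "1 / 6"] deriv_theta_odd_minus[OF assms, of "1 / 6"]
    by (simp add: power2_eq_square power3_eq_cube algebra_simps)
  have "?S (1 / 6) \<noteq> 0" "?S (1 / 2) \<noteq> 0"
    using theta_odd_nonzero[OF assms, of 3 "1 / 6"] theta_odd_nonzero[OF assms, of 1 "1 / 2"] by simp_all
  with key have "- ?S' (1 / 6) = 1 / 3 * (- ?S' 0 * ?S (1 / 3) ^ 3 / (?S (1 / 6) ^ 2 * ?S (1 / 2)))"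
    by (simp add: field_simps)
  moreover have "theta_deriv_const 1 (2 / 3) \<tau> = - ?S' (1 / 6)" "theta_deriv_const 1 1 \<tau> = - ?S' 0"
    "theta_const 1 (1 / 3) \<tau> = ?S (1 / 3)" "theta_const 1 (2 / 3) \<tau> = ?S (1 / 6)"
    "theta_const 1 0 \<tau> = ?S (1 / 2)"
    using deriv_theta_odd_reflect[OF assms, of "1 / 6"] deriv_theta_odd_reflect[OF assms, of 0]
      theta_odd_reflect[of \<tau> "1 / 3"] theta_odd_reflect[of \<tau> "1 / 6"]
    by (simp_all add: theta_const_eq_theta_odd theta_deriv_const_eq_deriv_theta_odd[OF assms])
  ultimately show ?thesis by simp
qed

end
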